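(* Let $G$ be a graph of order $n$ with clique number $\omega(G)=\omega$. Then \[ q(G)\leq\frac{2\omega-2}{\omega}\,n+8 . \]
   Context: All graphs are finite and simple. For a graph $G$, let $A$ be its adjacency matrix and $D$ the diagonal matrix of its vertex degrees; $q(G)$ denotes the largest eigenvalue of the signless Laplacian $Q(G)=A+D$. The clique number $\omega(G)$ is the largest order of a complete subgraph of $G$. *)

theory Defs
  imports Graph_Theory.Kuratowski Jordan_Normal_Form.Spectral_Radius
begin

text \<open>
  A finite simple graph is a \<open>graph\<close> of \<open>Graph_Theory\<close>: a finite, loop-free, symmetric
  digraph without multiple arcs, so each edge \<open>uv\<close> is the pair of arcs from \<open>u\<close> to \<open>v\<close> and
  from \<open>v\<close> to \<open>u\<close>, and the degree of a vertex is its out-degree.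

  Matrices in \<open>Jordan_Normal_Form\<close> have rows and columns indexed by \<open>0, \<dots>, n - 1\<close>, so the
  matrices of a graph depend on a listing \<open>vs\<close> of its vertices without repetition; another
  listing only conjugates them by a permutation matrix.
\<close>

definition adjacency_mat :: "'a list \<Rightarrow> ('a, 'b) pre_digraph \<Rightarrow> real mat" where
  "adjacency_mat vs G =
     mat (length vs) (length vs) (\<lambda>(i, j). if (vs ! i, vs ! j) \<in> arcs_ends G then 1 else 0)"

definition degree_mat :: "'a list \<Rightarrow> ('a, 'b) pre_digraph \<Rightarrow> real mat" where
  "degree_mat vs G =
     mat (length vs) (length vs) (\<lambda>(i, j). if i = j then real (out_degree G (vs ! i)) else 0)"

definition signless_laplacian :: "'a list \<Rightarrow> ('a, 'b) pre_digraph \<Rightarrow> real mat" where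
  "signless_laplacian vs G = adjacency_mat vs G + degree_mat vs G"

text \<open>
  The signless Laplacian is real symmetric, so its spectrum over the reals contains all of its
  eigenvalues. It is finite, and nonempty if the graph has a vertex, so \<open>Max\<close> is a true maximum.
\<close>

definition q_index :: "'a list \<Rightarrow> ('a, 'b) pre_digraph \<Rightarrow> real" where
  "q_index vs G = Max (spectrum (signless_laplacian vs G))"

definition clique_number :: "('a, 'b) pre_digraph \<Rightarrow> nat" where
  "clique_number G = Max {k. \<exists>H. subgraph H G \<and> complete_digraph k H}"

end

theory Submission
  imports Defs "HOL-Analysis.Convex"
begin

text \<open>
  The argument is that of Motzkin and Straus for the clique number. Fix a vector \<open>x\<close>, give the
  vertices weights \<open>p\<close>, and put \<open>c = 2 (1 - 1/\<omega>)\<close>. Consider the quadratic form in \<open>p\<close> given by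
  the sum of \<open>p\<^sub>i p\<^sub>j (x\<^sub>i + x\<^sub>j)\<^sup>2\<close> over the edges \<open>ij\<close> minus \<open>c (\<Sum> p\<^sub>i) (\<Sum> p\<^sub>i x\<^sub>i\<^sup>2)\<close>.
  Moving weight between two nonadjacent vertices changes it linearly, so weight can be moved,
  without decreasing the form, until one of the two vertices has weight \<open>0\<close>. One ends on a clique
  with at most \<open>\<omega>\<close> vertices, where the Cauchy-Schwarz inequality shows that the form is not
  positive. For \<open>p = 1\<close> and \<open>x\<close> an eigenvector this bounds every eigenvalue of the signless
  Laplacian by \<open>c n\<close>, even without the additive constant \<open>8\<close>.
\<close>

section \<open>Moving weight between two vertices in a quadratic form\<close>

lemma sum_mult_shift:
  fixes h :: "'a \<Rightarrow> real"
  assumes "finite S" "u \<in> S" "v \<in> S" "u \<noteq> v"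
  shows "(\<Sum>i\<in>S. (p(u := p u - t, v := p v + t)) i * h i) = (\<Sum>i\<in>S. p i * h i) + t * (h v - h u)"
proof -
  have "(\<Sum>i\<in>S. (p(u := p u - t, v := p v + t)) i * h i)
      = (\<Sum>i\<in>S. p i * h i + ((if i = v then t * h i else 0) - (if i = u then t * h i else 0)))"
    using assms(4) by (intro sum.cong) (auto simp: algebra_simps)
  also have "\<dots> = (\<Sum>i\<in>S. p i * h i) + t * (h v - h u)"
    using assms by (simp add: sum.distrib sum_subtractf right_diff_distrib)
  finally show ?thesis .
qed

text \<open>This is the second-order expansion of the form at \<open>p\<close> in the direction that
  lowers \<open>u\<close> and raises \<open>v\<close>. It is exact, and the coefficient of
  \<open>t\<^sup>2\<close> is the value of the form on that direction.\<close>

lemma quadratic_form_shift: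
  fixes a :: "'a \<Rightarrow> 'a \<Rightarrow> real"
  assumes "finite S" "u \<in> S" "v \<in> S" "u \<noteq> v"
    and sym: "\<And>i j. a i j = a j i"
  shows "(\<Sum>i\<in>S. \<Sum>j\<in>S. (p(u := p u - t, v := p v + t)) i * (p(u := p u - t, v := p v + t)) j * a i j)
    = (\<Sum>i\<in>S. \<Sum>j\<in>S. p i * p j * a i j) + 2 * t * (\<Sum>j\<in>S. p j * (a v j - a u j))
      + t\<^sup>2 * (a u u + a v v - 2 * a u v)"
proof -
  let ?p = "p(u := p u - t, v := p v + t)"
  define M where "M i = (\<Sum>j\<in>S. p j * a i j)" for i
  note shift = sum_mult_shift[OF assms(1-4)]
  have inner: "(\<Sum>j\<in>S. ?p j * a i j) = M i + t * (a v i - a u i)" for i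
    unfolding shift M_def by (simp only: sym[of i])
  have M: "(\<Sum>j\<in>S. p j * (a v j - a u j)) = M v - M u"
    by (simp add: M_def right_diff_distrib sum_subtractf)
  have "(\<Sum>i\<in>S. \<Sum>j\<in>S. ?p i * ?p j * a i j) = (\<Sum>i\<in>S. ?p i * (\<Sum>j\<in>S. ?p j * a i j))"
    by (simp only: sum_distrib_left mult.assoc)
  also have "\<dots> = (\<Sum>i\<in>S. p i * (M i + t * (a v i - a u i)))
      + t * ((M v + t * (a v v - a u v)) - (M u + t * (a v u - a u u)))"
    unfolding inner by (rule shift)
  also have "(\<Sum>i\<in>S. p i * (M i + t * (a v i - a u i)))
      = (\<Sum>i\<in>S. p i * M i) + t * (\<Sum>i\<in>S. p i * (a v i - a u i))"
    by (simp add: distrib_left sum.distrib sum_distrib_left mult.left_commute)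
  also have "\<dots> + t * ((M v + t * (a v v - a u v)) - (M u + t * (a v u - a u u)))
      = (\<Sum>i\<in>S. p i * M i) + 2 * t * (\<Sum>j\<in>S. p j * (a v j - a u j))
        + t\<^sup>2 * (a u u + a v v - 2 * a u v)"
    unfolding M sym[of v u] by (simp add: power2_eq_square algebra_simps)
  also have "(\<Sum>i\<in>S. p i * M i) = (\<Sum>i\<in>S. \<Sum>j\<in>S. p i * p j * a i j)"
    by (simp only: M_def sum_distrib_left mult.assoc)
  finally show ?thesis .
qed

text \<open>The assumption \<open>convex\<close> makes the form convex along a shift of weight
  between unrelated \<open>u\<close> and \<open>v\<close>, so one of the two directions never
  decreases it. Following that direction until a weight vanishes shrinks the support. Since the
  weights change on the way, the induction is over all \<open>p\<close>, and \<open>clique\<close>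
  must allow arbitrary nonnegative weights.\<close>

lemma quadratic_form_nonpos_if_cliques:
  fixes a :: "'a \<Rightarrow> 'a \<Rightarrow> real"
  assumes "finite S" and "\<And>i. i \<in> S \<Longrightarrow> p i \<ge> 0"
    and sym: "\<And>i j. a i j = a j i"
    and convex: "\<And>u v. u \<in> S \<Longrightarrow> v \<in> S \<Longrightarrow> u \<noteq> v \<Longrightarrow> \<not> R u v \<Longrightarrow> 2 * a u v \<le> a u u + a v v"
    and clique: "\<And>K p. K \<subseteq> S \<Longrightarrow> \<forall>i\<in>K. \<forall>j\<in>K. i \<noteq> j \<longrightarrow> R i j \<Longrightarrow> \<forall>i\<in>K. p i \<ge> 0 \<Longrightarrow>
      (\<Sum>i\<in>K. \<Sum>j\<in>K. p i * p j * a i j) \<le> 0"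
  shows "(\<Sum>i\<in>S. \<Sum>j\<in>S. p i * p j * a i j) \<le> 0"
  using assms(1,2,4,5)
proof (induction S arbitrary: p rule: finite_psubset_induct)
  case (psubset S)
  show ?case
  proof (cases "\<forall>i\<in>S. \<forall>j\<in>S. i \<noteq> j \<longrightarrow> R i j")
    case True
    then show ?thesis using psubset.prems by blast
  next
    case False
    then obtain u v where uv: "u \<in> S" "v \<in> S" "u \<noteq> v" "\<not> R u v" by blast
    define L where "L = (\<Sum>j\<in>S. p j * (a v j - a u j))"
    \<comment> \<open>The sign of \<open>t\<close> is that of the slope \<open>L\<close>, so the
      linear term is nonnegative; its size is the full weight of the vertex to be emptied, which is
      \<open>w\<close> below.\<close>
    define t where "t = (if L \<ge> 0 then p u else - p v)"
    define p' where "p' = p(u := p u - t, v := p v + t)"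
    define w where "w = (if L \<ge> 0 then u else v)"
    have w: "w \<in> S" "p' w = 0" using uv by (auto simp: w_def p'_def t_def)
    have drop: "(\<Sum>i\<in>S. g i) = (\<Sum>i\<in>S - {w}. g i)" if "g w = 0" for g :: "'a \<Rightarrow> real"
      using sum.remove[OF psubset.hyps(1) w(1), of g] that by simp
    have p': "p' i \<ge> 0" if "i \<in> S" for i
      using psubset.prems(1)[OF that] psubset.prems(1)[OF uv(1)] psubset.prems(1)[OF uv(2)]
      by (auto simp: p'_def t_def)
    have "t * L \<ge> 0"
      using psubset.prems(1)[OF uv(1)] psubset.prems(1)[OF uv(2)]
      by (auto simp: t_def mult_le_0_iff)
    moreover have "t\<^sup>2 * (a u u + a v v - 2 * a u v) \<ge> 0"
      using psubset.prems(2)[OF uv] by simp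
    moreover have "(\<Sum>i\<in>S. \<Sum>j\<in>S. p' i * p' j * a i j)
        = (\<Sum>i\<in>S. \<Sum>j\<in>S. p i * p j * a i j) + 2 * t * L + t\<^sup>2 * (a u u + a v v - 2 * a u v)"
      unfolding p'_def L_def by (rule quadratic_form_shift[OF psubset.hyps(1) uv(1-3) sym])
    ultimately have "(\<Sum>i\<in>S. \<Sum>j\<in>S. p i * p j * a i j) \<le> (\<Sum>i\<in>S. \<Sum>j\<in>S. p' i * p' j * a i j)"
      by linarith
    also have "\<dots> = (\<Sum>i\<in>S - {w}. \<Sum>j\<in>S - {w}. p' i * p' j * a i j)"
      using w(2) by (simp add: drop)
    also have "\<dots> \<le> 0"
    proof (rule psubset.IH)
      show "S - {w} \<subset> S" using w by blast
      show "\<And>i. i \<in> S - {w} \<Longrightarrow> 0 \<le> p' i" using p' by blast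
      show "2 * a i j \<le> a i i + a j j"
        if "i \<in> S - {w}" "j \<in> S - {w}" "i \<noteq> j" "\<not> R i j" for i j
        using psubset.prems(2) that by blast
      show "(\<Sum>i\<in>K. \<Sum>j\<in>K. q i * q j * a i j) \<le> 0"
        if "K \<subseteq> S - {w}" "\<forall>i\<in>K. \<forall>j\<in>K. i \<noteq> j \<longrightarrow> R i j" "\<forall>i\<in>K. 0 \<le> q i" for K q
        using psubset.prems(3)[of K q] that by blast
    qed
    finally show ?thesis .
  qed
qed

section \<open>The form on a clique\<close>

lemma weighted_sum_squared_le:
  fixes p x :: "'a \<Rightarrow> real"
  assumes "\<And>i. i \<in> K \<Longrightarrow> p i \<ge> 0"
  shows "(\<Sum>i\<in>K. p i * x i)\<^sup>2 \<le> (\<Sum>i\<in>K. p i) * (\<Sum>i\<in>K. p i * (x i)\<^sup>2)"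
proof -
  have "(\<Sum>i\<in>K. sqrt (p i) * (sqrt (p i) * x i))\<^sup>2
      \<le> (\<Sum>i\<in>K. (sqrt (p i))\<^sup>2) * (\<Sum>i\<in>K. (sqrt (p i) * x i)\<^sup>2)"
    by (rule Cauchy_Schwarz_ineq_sum)
  then show ?thesis
    using assms by (simp add: mult.assoc[symmetric] power_mult_distrib cong: sum.cong)
qed

text \<open>In terms of the sums \<open>P\<close>, \<open>Q\<close>, \<open>T\<close>,
  \<open>W\<close> the form is \<open>2 * (1 - c) * P * Q + 2 * T\<^sup>2 - 4 * W\<close>.
  Cauchy-Schwarz gives both \<open>T\<^sup>2 \<le> P * Q\<close> and
  \<open>T\<^sup>2 \<le> \<omega> * W\<close>; averaging them with weights
  \<open>1 - 2 / \<omega>\<close> and \<open>2 / \<omega>\<close> yields exactly the required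
  bound.\<close>

lemma clique_form_nonpos:
  fixes p x :: "'a \<Rightarrow> real"
  assumes "finite K" "card K \<le> \<omega>" and p: "\<And>i. i \<in> K \<Longrightarrow> p i \<ge> 0"
  shows "(\<Sum>i\<in>K. \<Sum>j\<in>K. p i * p j * ((if i \<noteq> j then (x i + x j)\<^sup>2 else 0)
      - 2 * (1 - 1 / real \<omega>) * ((x i)\<^sup>2 + (x j)\<^sup>2))) \<le> 0"
proof (cases "K = {}")
  case False
  define c where "c = 2 * (1 - 1 / real \<omega>)"
  define P where "P = (\<Sum>i\<in>K. p i)"
  define Q where "Q = (\<Sum>i\<in>K. p i * (x i)\<^sup>2)"
  define T where "T = (\<Sum>i\<in>K. p i * x i)"
  define W where "W = (\<Sum>i\<in>K. (p i * x i)\<^sup>2)"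
  have k: "card K \<ge> 1" using False assms(1) by (simp add: Suc_le_eq card_gt_0_iff)
  \<comment> \<open>Extending the square \<open>(x i + x j)\<^sup>2\<close> to the diagonal lets the
    double sums factor; the last term takes the diagonal back out.\<close>
  have "(\<Sum>i\<in>K. \<Sum>j\<in>K. p i * p j * ((if i \<noteq> j then (x i + x j)\<^sup>2 else 0) - c * ((x i)\<^sup>2 + (x j)\<^sup>2)))
     = (\<Sum>i\<in>K. \<Sum>j\<in>K. (1 - c) * (p i * (x i)\<^sup>2 * p j) + (1 - c) * (p i * (p j * (x j)\<^sup>2))
          + 2 * ((p i * x i) * (p j * x j)) - (if i = j then 4 * (p i * x i)\<^sup>2 else 0))"
    by (intro sum.cong refl) (auto simp: power2_eq_square algebra_simps)
  also have "\<dots> = (1 - c) * (Q * P) + (1 - c) * (P * Q) + 2 * (T * T) - 4 * W"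
    using assms(1)
    by (simp add: sum.distrib sum_subtractf sum_distrib_left[symmetric] sum_distrib_right[symmetric]
        P_def Q_def T_def W_def)
  also have "\<dots> \<le> 0"
  \<comment> \<open>For a single vertex \<open>\<omega>\<close> may be 1, and then the weight
    \<open>1 - 2 / \<omega>\<close> is negative. The form is then
    \<open>- 2 * c * (p i * x i)\<^sup>2\<close>, which is handled directly.\<close>
  proof (cases "card K = 1")
    case True
    then obtain i where i: "K = {i}" by (rule card_1_singletonE)
    have "real \<omega> \<ge> 1" using k assms(2) by linarith
    then have "0 \<le> c" by (simp add: c_def field_simps)
    then have "0 \<le> c * (p i * (p i * (x i)\<^sup>2))" by (intro mult_nonneg_nonneg) (auto simp: p i)
    then show ?thesis
      by (simp add: i P_def Q_def T_def W_def power2_eq_square algebra_simps)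
  next
    case False
    then have w: "real \<omega> \<ge> 2" using k assms(2) by linarith
    have TPQ: "T\<^sup>2 \<le> P * Q"
      unfolding T_def P_def Q_def using p by (rule weighted_sum_squared_le)
    have "T\<^sup>2 \<le> W * real (card K)"
      unfolding T_def W_def using sum_squared_le_sum_of_squares[of "\<lambda>i. p i * x i" K] assms(1)
      by (simp add: mult.commute)
    also have "\<dots> \<le> W * real \<omega>"
      using assms(2) by (intro mult_left_mono) (auto simp: W_def sum_nonneg)
    finally have TW: "2 / real \<omega> * T\<^sup>2 \<le> 2 * W" using w by (simp add: field_simps)
    have "(1 - 2 / real \<omega>) * T\<^sup>2 \<le> (1 - 2 / real \<omega>) * (P * Q)"
      using TPQ w by (intro mult_left_mono) auto
    with TW have "T\<^sup>2 \<le> (1 - 2 / real \<omega>) * (P * Q) + 2 * W" by (simp add: algebra_simps)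
    moreover have "c - 1 = 1 - 2 / real \<omega>" by (simp add: c_def)
    ultimately have "T\<^sup>2 \<le> (c - 1) * (P * Q) + 2 * W" by simp
    then show ?thesis by (simp add: power2_eq_square algebra_simps)
  qed
  finally show ?thesis unfolding c_def .
qed simp

lemma signless_form_le:
  fixes x :: "'a \<Rightarrow> real"
  assumes "finite S" and sym: "\<And>i j. R i j \<longleftrightarrow> R j i" and irrefl: "\<And>i. \<not> R i i"
    and clique: "\<And>K. K \<subseteq> S \<Longrightarrow> \<forall>i\<in>K. \<forall>j\<in>K. i \<noteq> j \<longrightarrow> R i j \<Longrightarrow> card K \<le> \<omega>"
  shows "(\<Sum>i\<in>S. \<Sum>j\<in>S. if R i j then (x i + x j)\<^sup>2 else 0)
    \<le> 4 * (1 - 1 / real \<omega>) * real (card S) * (\<Sum>i\<in>S. (x i)\<^sup>2)"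
proof -
  define c where "c = 2 * (1 - 1 / real \<omega>)"
  \<comment> \<open>Summed over ordered pairs, \<open>a\<close> gives twice the form of the
    overview: the penalty is symmetrized in \<open>i\<close> and \<open>j\<close>. For nonadjacent
    vertices this makes the convexity condition an equality.\<close>
  define a where "a i j = (if R i j then (x i + x j)\<^sup>2 else 0) - c * ((x i)\<^sup>2 + (x j)\<^sup>2)" for i j
  have "(\<Sum>i\<in>S. \<Sum>j\<in>S. 1 * 1 * a i j) \<le> 0"
  proof (rule quadratic_form_nonpos_if_cliques[where R = R and p = "\<lambda>_. 1"])
    show "a i j = a j i" for i j
      using sym[of i j] by (simp add: a_def add.commute)
    show "2 * a u v \<le> a u u + a v v" if "\<not> R u v" for u v
      using that irrefl by (simp add: a_def algebra_simps)
    show "(\<Sum>i\<in>K. \<Sum>j\<in>K. p i * p j * a i j) \<le> 0"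
      if K: "K \<subseteq> S" "\<forall>i\<in>K. \<forall>j\<in>K. i \<noteq> j \<longrightarrow> R i j" "\<forall>i\<in>K. 0 \<le> p i" for K p
    proof -
      have R: "R i j \<longleftrightarrow> i \<noteq> j" if "i \<in> K" "j \<in> K" for i j
        using K(2) irrefl that by blast
      have "(\<Sum>i\<in>K. \<Sum>j\<in>K. p i * p j * a i j) = (\<Sum>i\<in>K. \<Sum>j\<in>K. p i * p j *
          ((if i \<noteq> j then (x i + x j)\<^sup>2 else 0) - c * ((x i)\<^sup>2 + (x j)\<^sup>2)))"
        by (intro sum.cong refl) (simp add: a_def R)
      also have "\<dots> \<le> 0"
        unfolding c_def using K(3) clique[OF K(1,2)] finite_subset[OF K(1) assms(1)]
        by (intro clique_form_nonpos) auto
      finally show ?thesis .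
    qed
  qed (use assms(1) in auto)
  moreover have "(\<Sum>i\<in>S. \<Sum>j\<in>S. c * ((x i)\<^sup>2 + (x j)\<^sup>2)) = 2 * c * real (card S) * (\<Sum>i\<in>S. (x i)\<^sup>2)"
    by (simp add: sum.distrib sum_distrib_left[symmetric] algebra_simps)
  ultimately show ?thesis
    by (simp add: a_def sum_subtractf c_def)
qed

section \<open>Existence of a real eigenvalue of a symmetric matrix\<close>

text \<open>Without this, \<open>q_index\<close> could be the unspecified maximum of an empty set.\<close>

lemma spectrum_symmetric_real_mat_nonempty:
  fixes A :: "real mat"
  assumes A: "A \<in> carrier_mat n n" and n: "n > 0"
    and sym: "\<And>i j. i < n \<Longrightarrow> j < n \<Longrightarrow> A $$ (i, j) = A $$ (j, i)"
  shows "spectrum A \<noteq> {}"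
proof -
  let ?B = "map_mat complex_of_real A"
  have B: "?B \<in> carrier_mat n n" using A by simp
  from spectrum_non_empty[OF B n] obtain k where k: "k \<in> spectrum ?B" by blast
  then obtain v where v: "v \<in> carrier_vec n" "v \<noteq> 0\<^sub>v n" "?B *\<^sub>v v = k \<cdot>\<^sub>v v"
    using A unfolding spectrum_def eigenvalue_def eigenvector_def by auto
  have row: "(\<Sum>j<n. complex_of_real (A $$ (i, j)) * v $ j) = k * v $ i" if "i < n" for i
  proof -
    have "(?B *\<^sub>v v) $ i = (k \<cdot>\<^sub>v v) $ i" by (simp only: v(3))
    then show ?thesis
      using that A v(1) by (simp add: scalar_prod_def atLeast0LessThan)
  qed
  \<comment> \<open>With \<open>F\<close> the Hermitian form of the matrix at \<open>v\<close>, the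
    eigenvalue equation gives \<open>F = k * N\<close>, while symmetry of the real matrix gives
    \<open>cnj F = F\<close>. As \<open>N\<close> is nonzero, \<open>k\<close> is real.\<close>
  define N where "N = (\<Sum>i<n. (cmod (v $ i))\<^sup>2)"
  define F where "F = (\<Sum>i<n. \<Sum>j<n. cnj (v $ i) * (complex_of_real (A $$ (i, j)) * v $ j))"
  have "F = (\<Sum>i<n. cnj (v $ i) * (k * v $ i))"
    unfolding F_def by (simp add: sum_distrib_left[symmetric] row)
  also have "\<dots> = k * of_real N"
    unfolding N_def by (simp add: sum_distrib_left complex_norm_square algebra_simps del: of_real_power)
  finally have F: "F = k * of_real N" .
  have "cnj F = (\<Sum>i<n. \<Sum>j<n. cnj (v $ j) * (complex_of_real (A $$ (i, j)) * v $ i))"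
    unfolding F_def by (simp add: cnj_sum algebra_simps)
  also have "\<dots> = (\<Sum>j<n. \<Sum>i<n. cnj (v $ j) * (complex_of_real (A $$ (i, j)) * v $ i))"
    by (rule sum.swap)
  also have "\<dots> = F" unfolding F_def by (intro sum.cong refl) (simp add: sym)
  finally have "cnj k * of_real N = k * of_real N" by (simp add: F)
  moreover have "N \<noteq> 0"
  proof -
    obtain i where i: "i < n" "v $ i \<noteq> 0" using v(1,2) by (metis carrier_vecD eq_vecI index_zero_vec)
    have "(cmod (v $ i))\<^sup>2 \<le> N" unfolding N_def using i by (intro member_le_sum) auto
    moreover have "(cmod (v $ i))\<^sup>2 > 0" using i by simp
    ultimately show ?thesis by linarith
  qed
  ultimately have "cnj k = k" by simp
  then have kr: "k = complex_of_real (Re k)" by (simp add: complex_eq_iff)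
  \<comment> \<open>The characteristic polynomial commutes with the embedding of the reals, so the
    real number \<open>k\<close> is already a root over the reals.\<close>
  have "poly (char_poly ?B) k = 0" using k spectrum_root_char_poly[OF B] by simp
  then have "poly (map_poly complex_of_real (char_poly A)) (complex_of_real (Re k)) = 0"
    using of_real_hom.char_poly_hom[OF A] kr by metis
  then have "poly (char_poly A) (Re k) = 0" by simp
  then show ?thesis using spectrum_root_char_poly[OF A] by blast
qed

section \<open>From graphs to the spectral bound\<close>

context graph
begin

text \<open>The subgraph induced on \<open>K\<close> is a complete digraph and so a witness in the
  definition of \<open>clique_number\<close>. The maximum there bounds it because orders of
  subgraphs are at most the order of \<open>G\<close>.\<close>

lemma card_clique_le_clique_number:
  assumes "K \<subseteq> verts G" "\<forall>u\<in>K. \<forall>v\<in>K. u \<noteq> v \<longrightarrow> (u, v) \<in> arcs_ends G"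
  shows "card K \<le> clique_number G"
proof -
  let ?H = "G \<restriction> K"
  let ?X = "{k. \<exists>H. subgraph H G \<and> complete_digraph k H}"
  have ends: "arcs_ends ?H = {(u, v). (u, v) \<in> K \<times> K \<and> u \<noteq> v}"
    using assms(2) no_loops by (fastforce simp: arcs_ends_conv)
  have "graph ?H"
  proof -
    interpret H: wf_digraph ?H by (rule wellformed_induce_subgraph)
    show ?thesis
    proof (unfold_locales)
      show "finite (verts ?H)" using finite_subset[OF assms(1) finite_verts] by simp
      show "symmetric ?H" unfolding symmetric_def ends by (auto simp: sym_def)
    qed (auto dest: no_loops no_multi_arcs)
  qed
  then have "card K \<in> ?X"
    using ends subgraph_induce_subgraphI[OF assms(1)] by (auto simp: complete_digraph_def)
  moreover have "?X \<subseteq> {..card (verts G)}"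
    by (auto simp: complete_digraph_def subgraph_def intro: card_mono)
  then have "finite ?X" by (rule finite_subset) simp
  ultimately show ?thesis unfolding clique_number_def by (intro Max_ge)
qed

text \<open>Arcs out of \<open>u\<close> correspond to their heads, as there are no parallel arcs,
  and heads to positions in \<open>vs\<close>, as the listing has no repetition.\<close>

lemma out_degree_eq_card_index:
  assumes "distinct vs" "set vs = verts G"
  shows "out_degree G u = card {j. j < length vs \<and> (u, vs ! j) \<in> arcs_ends G}"
proof -
  let ?J = "{j. j < length vs \<and> (u, vs ! j) \<in> arcs_ends G}"
  have "inj_on (head G) (out_arcs G u)"
    by (rule inj_onI) (auto simp: arc_to_ends_def intro: no_multi_arcs)
  then have "out_degree G u = card (head G ` out_arcs G u)"
    by (simp add: out_degree_def card_image)
  also have "head G ` out_arcs G u = (!) vs ` ?J"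
  proof (rule Set.set_eqI)
    fix w
    have "w \<in> head G ` out_arcs G u \<longleftrightarrow> (u, w) \<in> arcs_ends G"
      by (auto simp: arcs_ends_conv)
    also have "\<dots> \<longleftrightarrow> w \<in> set vs \<and> (u, w) \<in> arcs_ends G"
      using assms(2) adj_in_verts(2) by blast
    also have "\<dots> \<longleftrightarrow> w \<in> (!) vs ` ?J"
      unfolding in_set_conv_nth by blast
    finally show "w \<in> head G ` out_arcs G u \<longleftrightarrow> w \<in> (!) vs ` ?J" .
  qed
  also have "card ((!) vs ` ?J) = card ?J"
    using assms(1) by (intro card_image inj_onI) (auto simp: nth_eq_iff_index_eq)
  finally show ?thesis .
qed

text \<open>For an eigenvector \<open>x\<close>, the value \<open>k * N\<close> of the form of the
  signless Laplacian is the sum of \<open>(x i + x j)\<^sup>2\<close> over the edges. Ordered pairs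
  count each edge twice, whence the factor 2 in the computation.\<close>

lemma signless_laplacian_eigenvalue_le:
  assumes vs: "distinct vs" "set vs = verts G"
    and ev: "eigenvalue (signless_laplacian vs G) k"
  shows "k \<le> 2 * (1 - 1 / real (clique_number G)) * real (card (verts G))"
proof -
  define n where "n = length vs"
  have n: "n = card (verts G)" using vs distinct_card unfolding n_def by metis
  define R where "R i j \<longleftrightarrow> (vs ! i, vs ! j) \<in> arcs_ends G" for i j
  have R_sym: "R i j \<longleftrightarrow> R j i" for i j
    using arcs_ends_symmetric[OF sym_arcs] unfolding R_def by blast
  have R_irrefl: "\<not> R i i" for i
    unfolding R_def arcs_ends_conv by (auto, metis no_loops)
  define d where "d i = (\<Sum>j<n. if R i j then 1 else 0 :: real)" for i
  have d: "real (out_degree G (vs ! i)) = d i" for i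
    unfolding out_degree_eq_card_index[OF vs] d_def R_def n_def
    by (simp add: sum.If_cases Int_def)
  obtain v where v: "v \<in> carrier_vec n" "v \<noteq> 0\<^sub>v n" "signless_laplacian vs G *\<^sub>v v = k \<cdot>\<^sub>v v"
    using ev unfolding eigenvalue_def eigenvector_def
    by (auto simp: signless_laplacian_def adjacency_mat_def degree_mat_def n_def)
  define x where "x i = v $ i" for i
  have row: "k * x i = (\<Sum>j<n. if R i j then x j else 0) + d i * x i" if "i < n" for i
  proof -
    have "(signless_laplacian vs G *\<^sub>v v) $ i = (k \<cdot>\<^sub>v v) $ i" by (simp only: v(3))
    then have "k * x i = (\<Sum>j<n. ((if R i j then 1 else 0) + (if i = j then d i else 0)) * x j)"
      using that v(1)
      by (simp add: signless_laplacian_def adjacency_mat_def degree_mat_def scalar_prod_def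
          n_def[symmetric] R_def[symmetric] d atLeast0LessThan x_def cong: if_cong)
    also have "\<dots> = (\<Sum>j<n. (if R i j then x j else 0) + (if i = j then d i * x j else 0))"
      by (intro sum.cong refl) (auto simp: distrib_right)
    also have "\<dots> = (\<Sum>j<n. if R i j then x j else 0) + d i * x i"
      using that by (simp add: sum.distrib)
    finally show ?thesis .
  qed
  define N where "N = (\<Sum>i<n. (x i)\<^sup>2)"
  define b where "b = 1 - 1 / real (clique_number G)"
  have "2 * k * N = 2 * (\<Sum>i<n. x i * (k * x i))"
    by (simp add: N_def sum_distrib_left power2_eq_square algebra_simps)
  also have "\<dots> = (\<Sum>i<n. \<Sum>j<n. if R i j then 2 * (x i * x j) else 0)
      + 2 * (\<Sum>i<n. \<Sum>j<n. if R i j then (x i)\<^sup>2 else 0)"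
    by (simp add: row d_def distrib_left sum.distrib sum_distrib_left sum_distrib_right
        if_distrib power2_eq_square algebra_simps cong: if_cong)
  \<comment> \<open>The degree term appears twice; by symmetry of \<open>R\<close> one copy can
    carry \<open>x i\<close> and the other \<open>x j\<close>, which completes the square.\<close>
  also have "(\<Sum>i<n. \<Sum>j<n. if R i j then (x i)\<^sup>2 else 0) = (\<Sum>i<n. \<Sum>j<n. if R i j then (x j)\<^sup>2 else 0)"
    by (subst sum.swap) (simp add: R_sym)
  also have "2 * \<dots> = (\<Sum>i<n. \<Sum>j<n. if R i j then (x i)\<^sup>2 else 0) + \<dots>"
    by (subst (2) sum.swap) (simp add: R_sym)
  also have "(\<Sum>i<n. \<Sum>j<n. if R i j then 2 * (x i * x j) else 0) + \<dots>
      = (\<Sum>i<n. \<Sum>j<n. if R i j then (x i + x j)\<^sup>2 else 0)"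
    unfolding sum.distrib[symmetric]
    by (intro sum.cong refl) (simp add: power2_eq_square algebra_simps)
  also have "\<dots> \<le> 4 * (1 - 1 / real (clique_number G)) * real (card {..<n}) * N"
    unfolding N_def
  proof (rule signless_form_le)
    show "card K \<le> clique_number G" if K: "K \<subseteq> {..<n}" "\<forall>i\<in>K. \<forall>j\<in>K. i \<noteq> j \<longrightarrow> R i j" for K
    proof -
      have "inj_on ((!) vs) K"
        using K(1) by (intro inj_on_nth vs(1)) (auto simp: n_def)
      moreover have "card ((!) vs ` K) \<le> clique_number G"
      proof (rule card_clique_le_clique_number)
        show "(!) vs ` K \<subseteq> verts G" using K(1) unfolding vs(2)[symmetric] n_def by auto
        show "\<forall>u\<in>(!) vs ` K. \<forall>v\<in>(!) vs ` K. u \<noteq> v \<longrightarrow> (u, v) \<in> arcs_ends G"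
          using K(2) unfolding R_def by auto
      qed
      ultimately show ?thesis by (simp add: card_image)
    qed
  qed (use R_sym R_irrefl in auto)
  finally have "2 * k * N \<le> 4 * b * real n * N" by (simp add: b_def)
  then have "k * N \<le> 2 * b * real n * N" by linarith
  moreover have "N > 0"
  proof -
    obtain i where i: "i < n" "x i \<noteq> 0"
      using v(1,2) unfolding x_def by (metis carrier_vecD eq_vecI index_zero_vec)
    have "(x i)\<^sup>2 \<le> N" unfolding N_def using i by (intro member_le_sum) auto
    moreover have "(x i)\<^sup>2 > 0" using i by simp
    ultimately show ?thesis by linarith
  qed
  ultimately show ?thesis unfolding b_def n by simp
qed

end

theorem theorem5:
  fixes G :: "('a, 'b) pre_digraph" and vs :: "'a list" and n \<omega> :: nat
  assumes "graph G"
    and "verts G \<noteq> {}"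
    and "distinct vs" and "set vs = verts G"
    and "card (verts G) = n"
    and "clique_number G = \<omega>"
  shows "q_index vs G \<le> (2 * real \<omega> - 2) / real \<omega> * real n + 8"
proof -
  interpret graph G by (fact assms(1))
  let ?Q = "signless_laplacian vs G"
  have Q: "?Q \<in> carrier_mat (length vs) (length vs)"
    by (simp add: signless_laplacian_def adjacency_mat_def degree_mat_def)
  have "?Q $$ (i, j) = ?Q $$ (j, i)" if "i < length vs" "j < length vs" for i j
    using that arcs_ends_symmetric[OF sym_arcs]
    by (auto simp: signless_laplacian_def adjacency_mat_def degree_mat_def)
  then have ne: "spectrum ?Q \<noteq> {}"
    using assms(2,4) by (intro spectrum_symmetric_real_mat_nonempty[OF Q]) auto
  \<comment> \<open>Division by zero yields 0, so the two forms of the constant equated in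
    \<open>c\<close> below would differ at \<open>\<omega> = 0\<close>.\<close>
  have "\<omega> \<noteq> 0"
  proof -
    obtain u where "u \<in> verts G" using assms(2) by blast
    then have "card {u} \<le> \<omega>" unfolding assms(6)[symmetric] by (intro card_clique_le_clique_number) auto
    then show ?thesis by simp
  qed
  then have c: "2 * (1 - 1 / real \<omega>) = (2 * real \<omega> - 2) / real \<omega>" by (simp add: field_simps)
  have "q_index vs G \<in> spectrum ?Q"
    unfolding q_index_def using card_finite_spectrum(1)[OF Q] ne by (rule Max_in)
  then have "q_index vs G \<le> (2 * real \<omega> - 2) / real \<omega> * real n"
    using signless_laplacian_eigenvalue_le[OF assms(3,4)] unfolding spectrum_def assms(5,6) c by simp
  then show ?thesis by simp
qed

end
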